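(* Let $\Sigma$ be a signed graph on $n$ vertices with at least one negative edge, and let $\Sigma_+$ and $\Sigma_-$ be the spanning subgraphs consisting of only the positive, respectively only the negative, edges of $\Sigma$. Suppose $\Sigma_+$ has $m^+$ edges and $\Sigma_-$ has $m^-$ edges. Let $\epsilon_b(\Sigma_+)$ be the edge bipartiteness of $\Sigma_+$ and let $\omega(-\Sigma_-)$ be the clique number of the unsigned graph $-\Sigma_-$. Then \[\lambda_n(\Sigma)\ge-\sqrt{m^+-\epsilon_b(\Sigma_+)}-\sqrt{2m^-\left(1-\frac1{\omega(-\Sigma_-)}\right)}.\] Equality holds if $\Sigma=(K_n,-)$, or if $\Sigma=(K_{p,q},-)$ where $p+q=n$.
   Context: A signed graph $\Sigma=(G,\sigma)$ is a finite simple graph $G=(V,E)$ with a sign function $\sigma:E\to\{-1,+1\}$; its adjacency matrix $A(\Sigma)$ has $(i,j)$ entry $\sigma(v_iv_j)$ if $v_i\sim v_j$ and $0$ otherwise, and $\lambda_n(\Sigma)$ is its least eigenvalue. Spanning subgraphs have vertex set $V$. $-\Sigma_-$ is $\Sigma_-$ with all signs reversed, i.e. the unsigned graph on $V$ whose edges are the negative edges of $\Sigma$. The edge bipartiteness $\epsilon_b(G)$ of a graph $G$ is the minimum number of edges whose removal makes $G$ bipartite. The clique number is the maximum order of a complete subgraph. $(G,-)$ denotes the signed graph with underlying graph $G$ and all edges negative; $K_n$ and $K_{p,q}$ are the complete and complete bipartite graphs. *)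

theory Defs
  imports Complex_Main "Jordan_Normal_Form.Char_Poly"
begin

text \<open>
  A finite simple graph is a vertex set \<open>V\<close> with a set \<open>E\<close> of two-element subsets of \<open>V\<close>.
  All subgraphs below are spanning, so they are given by an edge set on the same \<open>V\<close>.
\<close>

definition simple_graph :: "'a set \<Rightarrow> 'a set set \<Rightarrow> bool" where
  "simple_graph V E \<longleftrightarrow> finite V \<and> (\<forall>e\<in>E. e \<subseteq> V \<and> card e = 2)"

text \<open>Only the values of \<open>\<sigma>\<close> on \<open>E\<close> are constrained (and used).\<close>

definition signed_graph :: "'a set \<Rightarrow> 'a set set \<Rightarrow> ('a set \<Rightarrow> int) \<Rightarrow> bool" where
  "signed_graph V E \<sigma> \<longleftrightarrow> simple_graph V E \<and> (\<forall>e\<in>E. \<sigma> e \<in> {-1, 1})"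

definition pos_edges :: "'a set set \<Rightarrow> ('a set \<Rightarrow> int) \<Rightarrow> 'a set set" where
  "pos_edges E \<sigma> = {e \<in> E. \<sigma> e = 1}"

definition neg_edges :: "'a set set \<Rightarrow> ('a set \<Rightarrow> int) \<Rightarrow> 'a set set" where
  "neg_edges E \<sigma> = {e \<in> E. \<sigma> e = -1}"

text \<open>The list \<open>vs\<close> enumerates the vertices; it fixes the order of the rows and columns.\<close>

definition adj_matrix :: "'a list \<Rightarrow> 'a set set \<Rightarrow> ('a set \<Rightarrow> int) \<Rightarrow> real mat" where
  "adj_matrix vs E \<sigma> = mat (length vs) (length vs)
     (\<lambda>(i, j). if {vs ! i, vs ! j} \<in> E then of_int (\<sigma> {vs ! i, vs ! j}) else 0)"

text \<open>
  Meaningful for real symmetric matrices of positive dimension, whose set of (real) eigenvalues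
  is finite and nonempty.
\<close>

definition least_eigenvalue :: "real mat \<Rightarrow> real" where
  "least_eigenvalue A = Min {k. eigenvalue A k}"

text \<open>One of the two parts may be empty.\<close>

definition bipartite :: "'a set \<Rightarrow> 'a set set \<Rightarrow> bool" where
  "bipartite V E \<longleftrightarrow>
     (\<exists>P Q. P \<union> Q = V \<and> P \<inter> Q = {} \<and> (\<forall>e\<in>E. \<exists>u\<in>P. \<exists>v\<in>Q. e = {u, v}))"

definition edge_bipartiteness :: "'a set \<Rightarrow> 'a set set \<Rightarrow> nat" where
  "edge_bipartiteness V E = Min {card F |F. F \<subseteq> E \<and> bipartite V (E - F)}"

definition clique :: "'a set \<Rightarrow> 'a set set \<Rightarrow> 'a set \<Rightarrow> bool" where
  "clique V E C \<longleftrightarrow> C \<subseteq> V \<and> (\<forall>u\<in>C. \<forall>v\<in>C. u \<noteq> v \<longrightarrow> {u, v} \<in> E)"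

definition clique_number :: "'a set \<Rightarrow> 'a set set \<Rightarrow> nat" where
  "clique_number V E = Max {card C |C. clique V E C}"

text \<open>\<open>(V, E)\<close> is a copy of the complete graph, respectively complete bipartite graph.\<close>

definition is_complete_graph :: "nat \<Rightarrow> 'a set \<Rightarrow> 'a set set \<Rightarrow> bool" where
  "is_complete_graph n V E \<longleftrightarrow> finite V \<and> card V = n \<and> E = {e. e \<subseteq> V \<and> card e = 2}"

definition is_complete_bipartite :: "nat \<Rightarrow> nat \<Rightarrow> 'a set \<Rightarrow> 'a set set \<Rightarrow> bool" where
  "is_complete_bipartite p q V E \<longleftrightarrow>
     (\<exists>P Q. finite P \<and> finite Q \<and> card P = p \<and> card Q = q \<and> P \<union> Q = V \<and> P \<inter> Q = {} \<and>
        E = {{u, v} |u v. u \<in> P \<and> v \<in> Q})"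

definition all_negative :: "'a set set \<Rightarrow> ('a set \<Rightarrow> int) \<Rightarrow> bool" where
  "all_negative E \<sigma> \<longleftrightarrow> (\<forall>e\<in>E. \<sigma> e = -1)"

end

theory Submission
  imports Defs "HOL-Analysis.Convex" "Jordan_Normal_Form.Spectral_Radius"
begin

text \<open>
  Let \<open>x\<close> be an eigenvector for a real eigenvalue \<open>k\<close>. Splitting the quadratic form of the signed
  adjacency matrix by the sign of the edges gives
  \<open>k \<parallel>x\<parallel>\<^sup>2 = f\<^sub>+(x) - f\<^sub>-(x)\<close>, where \<open>f\<^sub>+\<close> and \<open>f\<^sub>-\<close> are the quadratic forms of the
  unsigned graphs of positive and of negative edges. So it suffices to bound \<open>f\<^sub>-\<close> from above
  and \<open>f\<^sub>+\<close> from below.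

  For a graph with \<open>m\<close> edges all of whose cliques have at most \<open>r\<close> vertices, the
  Cauchy--Schwarz inequality over the \<open>2m\<close> ordered adjacent pairs bounds the form at \<open>\<bar>x\<bar>\<close> by
  \<open>\<surd>(2m)\<close> times the square root of the form at \<open>x\<^sup>2\<close>. The Motzkin--Straus inequality
  (\<open>motzkin_straus\<close>) bounds the latter by \<open>(1 - 1/r) \<parallel>x\<parallel>\<^sup>4\<close>, so that the form at \<open>\<bar>x\<bar>\<close> is
  at most \<open>\<surd>(2m (1 - 1/r)) \<parallel>x\<parallel>\<^sup>2\<close> (\<open>edge_form_abs_le\<close>). This is Nikiforov's bound on the
  spectral radius and settles \<open>f\<^sub>-\<close>.

  For \<open>f\<^sub>+\<close> only the edges joining a vertex with \<open>x \<ge> 0\<close> to one with \<open>x < 0\<close> contribute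
  negatively. They form a bipartite subgraph, which has at most \<open>m\<^sup>+ - \<epsilon>\<^sub>b\<close> edges and no clique on
  more than two vertices. Hence \<open>edge_form_abs_le\<close> applies again, now with \<open>r = 2\<close>, and yields
  \<open>edge_form_ge_bipartiteness\<close>.

  For the two families with all edges negative, the bound is itself an eigenvalue, with an explicit
  eigenvector; since no eigenvalue lies below the bound, it is the least one.
\<close>

section \<open>The quadratic form of a graph\<close>

text \<open>
  The sum runs over ordered pairs, so every edge counts twice: this is \<open>x\<^sup>T A x\<close> for the
  unsigned adjacency matrix \<open>A\<close>.
\<close>

definition edge_form :: "'a set \<Rightarrow> 'a set set \<Rightarrow> ('a \<Rightarrow> real) \<Rightarrow> real" where
  "edge_form V F x = (\<Sum>u\<in>V. \<Sum>w\<in>V. of_bool ({u, w} \<in> F) * (x u * x w))"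

lemma simple_graph_finite_edges:
  assumes "simple_graph V F"
  shows "finite F"
proof (rule finite_subset)
  show "F \<subseteq> Pow V" using assms by (auto simp: simple_graph_def)
  show "finite (Pow V)" using assms by (simp add: simple_graph_def)
qed

lemma simple_graph_subset: "simple_graph V F \<Longrightarrow> F' \<subseteq> F \<Longrightarrow> simple_graph V F'"
  by (auto simp: simple_graph_def)

lemma simple_graph_no_loop: "simple_graph V F \<Longrightarrow> {u, u} \<notin> F"
  by (auto simp: simple_graph_def)

lemma sum_adjacency:
  assumes "simple_graph V F"
  shows "(\<Sum>u\<in>V. \<Sum>w\<in>V. of_bool ({u, w} \<in> F)) = 2 * real (card F)"
proof -
  have fV: "finite V" and fF: "finite F"
    using assms simple_graph_finite_edges by (auto simp: simple_graph_def)
  have one: "(\<Sum>p\<in>V \<times> V. of_bool ({fst p, snd p} = e)) = (2 :: real)" if "e \<in> F" for e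
  proof -
    have "e \<subseteq> V" "card e = 2" using that assms by (auto simp: simple_graph_def)
    then obtain a b where e: "e = {a, b}" "a \<noteq> b" and ab: "a \<in> V" "b \<in> V"
      by (metis card_2_iff insert_subset)
    have "(\<Sum>p\<in>V \<times> V. of_bool ({fst p, snd p} = e)) = real (card {p \<in> V \<times> V. {fst p, snd p} = e})"
      using fV by (simp add: of_bool_def sum.If_cases Int_def conj_commute)
    also have "{p \<in> V \<times> V. {fst p, snd p} = e} = {(a, b), (b, a)}"
      using e ab by (auto simp: doubleton_eq_iff)
    finally show ?thesis using e by simp
  qed
  have "(\<Sum>u\<in>V. \<Sum>w\<in>V. of_bool ({u, w} \<in> F))
      = (\<Sum>p\<in>V \<times> V. of_bool ({fst p, snd p} \<in> F) :: real)"
    by (simp add: sum.cartesian_product case_prod_unfold)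
  also have "\<dots> = (\<Sum>p\<in>V \<times> V. \<Sum>e\<in>F. of_bool ({fst p, snd p} = e))"
    using fF by (intro sum.cong) (auto simp: of_bool_def)
  also have "\<dots> = (\<Sum>e\<in>F. \<Sum>p\<in>V \<times> V. of_bool ({fst p, snd p} = e))"
    by (rule sum.swap)
  also have "\<dots> = 2 * real (card F)" using one by simp
  finally show ?thesis .
qed

section \<open>Cliques and the Motzkin--Straus bound\<close>

text \<open>
  Along the direction \<open>d = e\<^sub>u - e\<^sub>w\<close> the form is affine when \<open>u\<close> and \<open>w\<close> are not adjacent,
  because its quadratic part only involves the entries of the adjacency matrix at \<open>u\<close> and \<open>w\<close>,
  which all vanish. So moving the whole weight of \<open>w\<close> to a vertex \<open>u\<close> with at least as heavy a
  neighbourhood cannot decrease the form.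
\<close>

lemma edge_form_transfer:
  assumes G: "simple_graph V F" and uw: "u \<in> V" "w \<in> V" "u \<noteq> w" "{u, w} \<notin> F"
    and le: "(\<Sum>t\<in>V. of_bool ({w, t} \<in> F) * y t) \<le> (\<Sum>t\<in>V. of_bool ({u, t} \<in> F) * y t)"
    and pos: "0 \<le> y w"
  shows "edge_form V F y \<le> edge_form V F (y(u := y u + y w, w := 0))"
proof -
  have fV: "finite V" using G by (simp add: simple_graph_def)
  define d where "d t = y w * (of_bool (t = u) - of_bool (t = w))" for t
  define L where "L z s = (\<Sum>t\<in>V. of_bool ({s, t} \<in> F) * z t)" for z :: "'a \<Rightarrow> real" and s
  have y': "y(u := y u + y w, w := 0) = (\<lambda>t. y t + d t)"
    using uw by (auto simp: d_def)
  have form: "edge_form V F z = (\<Sum>s\<in>V. z s * L z s)" for z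
    unfolding edge_form_def L_def by (simp add: sum_distrib_left mult_ac)
  have dsum: "(\<Sum>s\<in>V. d s * g s) = y w * (g u - g w)" for g
  proof -
    have "(\<Sum>s\<in>V. d s * g s)
        = (\<Sum>s\<in>V. (if s = u then y w * g s else 0) - (if s = w then y w * g s else 0))"
      by (intro sum.cong) (auto simp: d_def)
    also have "\<dots> = y w * g u - y w * g w"
      using uw fV by (simp add: sum_subtractf)
    finally show ?thesis by (simp add: algebra_simps)
  qed
  have Ld: "L d s = y w * (of_bool ({s, u} \<in> F) - of_bool ({s, w} \<in> F))" for s
    using dsum[of "\<lambda>t. of_bool ({s, t} \<in> F)"] by (simp add: L_def mult_ac)
  have Ladd: "L (\<lambda>t. y t + d t) s = L y s + L d s" for s
    by (simp add: L_def algebra_simps sum.distrib)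
  have symm: "(\<Sum>s\<in>V. y s * L d s) = (\<Sum>s\<in>V. d s * L y s)"
    unfolding L_def sum_distrib_left
    by (subst sum.swap) (simp add: insert_commute mult_ac)
  have "edge_form V F (\<lambda>t. y t + d t)
      = edge_form V F y + 2 * (\<Sum>s\<in>V. d s * L y s) + (\<Sum>s\<in>V. d s * L d s)"
    unfolding form Ladd using symm by (simp add: algebra_simps sum.distrib)
  also have "(\<Sum>s\<in>V. d s * L d s) = 0"
    unfolding dsum Ld using simple_graph_no_loop[OF G] uw by (simp add: insert_commute)
  also have "(\<Sum>s\<in>V. d s * L y s) = y w * (L y u - L y w)" by (rule dsum)
  finally show ?thesis unfolding y' using le pos by (simp add: L_def)
qed

text \<open>
  The Motzkin--Straus inequality, in homogeneous form. If the support of \<open>y\<close> is not a clique, a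
  weight transfer between two non-adjacent support vertices shrinks the support while it keeps the
  total weight and does not decrease the form. If the support is a clique, the form is at
  most the sum over all pairs of distinct vertices, \<open>(\<Sum> y)\<^sup>2 - \<Sum> y\<^sup>2\<close>, and
  \<open>\<Sum> y\<^sup>2 \<ge> (\<Sum> y)\<^sup>2 / r\<close> since at most \<open>r\<close> weights are nonzero.
\<close>

theorem motzkin_straus:
  assumes G: "simple_graph V F" and cl: "\<And>C. clique V F C \<Longrightarrow> card C \<le> r"
    and pos: "\<And>u. u \<in> V \<Longrightarrow> 0 \<le> y u"
  shows "edge_form V F y \<le> (1 - 1 / real r) * (\<Sum>u\<in>V. y u)\<^sup>2"
  using pos
proof (induction "card {u \<in> V. y u \<noteq> 0}" arbitrary: y rule: less_induct)
  case less
  have fV: "finite V" using G by (simp add: simple_graph_def)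
  define S where "S = {u \<in> V. y u \<noteq> 0}"
  have S: "S \<subseteq> V" "finite S" using fV by (auto simp: S_def)
  show ?case
  proof (cases "clique V F S")
    case True
    have sumS: "(\<Sum>u\<in>V. y u) = (\<Sum>u\<in>S. y u)"
      using fV by (intro sum.mono_neutral_right) (auto simp: S_def)
    have sqS: "(\<Sum>u\<in>V. (y u)\<^sup>2) = (\<Sum>u\<in>S. (y u)\<^sup>2)"
      using fV by (intro sum.mono_neutral_right) (auto simp: S_def)
    have "(\<Sum>u\<in>S. y u)\<^sup>2 \<le> real r * (\<Sum>u\<in>S. (y u)\<^sup>2)"
    proof -
      have "(\<Sum>u\<in>S. y u)\<^sup>2 \<le> (\<Sum>u\<in>S. (y u)\<^sup>2) * real (card S)"
        by (rule sum_squared_le_sum_of_squares)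
      also have "\<dots> \<le> (\<Sum>u\<in>S. (y u)\<^sup>2) * real r"
        using cl[OF True] by (intro mult_left_mono) (auto intro: sum_nonneg)
      finally show ?thesis by (simp add: mult.commute)
    qed
    then have sq: "(\<Sum>u\<in>V. y u)\<^sup>2 / real r \<le> (\<Sum>u\<in>V. (y u)\<^sup>2)"
      unfolding sumS sqS
      by (cases "r = 0") (auto simp: divide_le_eq mult.commute intro: sum_nonneg)
    have "edge_form V F y \<le> (\<Sum>u\<in>V. \<Sum>w\<in>V. y u * y w - (if w = u then (y u)\<^sup>2 else 0))"
      unfolding edge_form_def using less.prems simple_graph_no_loop[OF G]
      by (intro sum_mono) (auto simp: power2_eq_square)
    also have "\<dots> = (\<Sum>u\<in>V. y u)\<^sup>2 - (\<Sum>u\<in>V. (y u)\<^sup>2)"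
      using fV by (simp add: sum_subtractf power2_eq_square sum_product)
    finally show ?thesis using sq by (simp add: algebra_simps)
  next
    case False
    then obtain u w where uw: "u \<in> S" "w \<in> S" "u \<noteq> w" "{u, w} \<notin> F"
      using S by (auto simp: clique_def)
    have step: ?thesis if uw: "u \<in> S" "w \<in> S" "u \<noteq> w" "{u, w} \<notin> F"
      and le: "(\<Sum>t\<in>V. of_bool ({w, t} \<in> F) * y t) \<le> (\<Sum>t\<in>V. of_bool ({u, t} \<in> F) * y t)"
      for u w
    proof -
      define y' where "y' = y(u := y u + y w, w := 0)"
      have V: "u \<in> V" "w \<in> V" using uw S by auto
      have "{t \<in> V. y' t \<noteq> 0} \<subseteq> S - {w}"
        using uw by (auto simp: y'_def S_def split: if_splits)
      then have "{t \<in> V. y' t \<noteq> 0} \<subset> S"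
        using uw by blast
      then have "card {t \<in> V. y' t \<noteq> 0} < card S"
        by (rule psubset_card_mono[OF S(2)])
      moreover have "\<And>t. t \<in> V \<Longrightarrow> 0 \<le> y' t"
        using less.prems V by (auto simp: y'_def)
      ultimately have "edge_form V F y' \<le> (1 - 1 / real r) * (\<Sum>t\<in>V. y' t)\<^sup>2"
        using less.hyps[of y'] by (simp add: S_def)
      moreover have "edge_form V F y \<le> edge_form V F y'"
        unfolding y'_def using edge_form_transfer[OF G V uw(3,4) le] less.prems V by simp
      moreover have "(\<Sum>t\<in>V. y' t) = (\<Sum>t\<in>V. y t)"
      proof -
        have "(\<Sum>t\<in>V. y' t)
            = (\<Sum>t\<in>V. y t + ((if t = u then y w else 0) - (if t = w then y w else 0)))"
          using uw by (intro sum.cong) (auto simp: y'_def)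
        also have "\<dots> = (\<Sum>t\<in>V. y t)"
          using fV V by (simp add: sum.distrib sum_subtractf)
        finally show ?thesis .
      qed
      ultimately show ?thesis by simp
    qed
    show ?thesis
    proof (cases "(\<Sum>t\<in>V. of_bool ({w, t} \<in> F) * y t) \<le> (\<Sum>t\<in>V. of_bool ({u, t} \<in> F) * y t)")
      case True
      then show ?thesis using step[of u w] uw by blast
    next
      case False
      then show ?thesis using step[of w u] uw by (simp add: insert_commute)
    qed
  qed
qed

text \<open>
  Nikiforov's bound. In the Cauchy--Schwarz inequality over ordered pairs of vertices, one factor is
  the adjacency indicator, whose squares add up to \<open>2 |F|\<close>, and the squares of the other
  factor add up to the form at \<open>x\<^sup>2\<close>, to which the Motzkin--Straus inequality applies.
\<close>

lemma edge_form_abs_le: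
  assumes G: "simple_graph V F" and cl: "\<And>C. clique V F C \<Longrightarrow> card C \<le> r"
  shows "edge_form V F (\<lambda>u. \<bar>x u\<bar>)
    \<le> sqrt (2 * real (card F) * (1 - 1 / real r)) * (\<Sum>u\<in>V. (x u)\<^sup>2)"
proof -
  define a where "a p = (of_bool ({fst p, snd p} \<in> F) :: real)" for p
  define b where "b p = a p * (\<bar>x (fst p)\<bar> * \<bar>x (snd p)\<bar>)" for p
  let ?s = "\<Sum>u\<in>V. (x u)\<^sup>2"
  have s: "0 \<le> ?s" by (simp add: sum_nonneg)
  have form: "edge_form V F (\<lambda>u. \<bar>x u\<bar>) = (\<Sum>p\<in>V \<times> V. a p * b p)"
    unfolding edge_form_def sum.cartesian_product a_def b_def
    by (intro sum.cong) auto
  have A: "(\<Sum>p\<in>V \<times> V. (a p)\<^sup>2) = 2 * real (card F)"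
    unfolding sum_adjacency[OF G, symmetric] sum.cartesian_product a_def
    by (intro sum.cong) auto
  have "(\<Sum>p\<in>V \<times> V. (b p)\<^sup>2) = edge_form V F (\<lambda>u. (x u)\<^sup>2)"
    unfolding edge_form_def sum.cartesian_product a_def b_def
    by (intro sum.cong) (auto simp: power_mult_distrib)
  also have "\<dots> \<le> (1 - 1 / real r) * ?s\<^sup>2"
    by (rule motzkin_straus[OF G cl]) auto
  finally have B: "(\<Sum>p\<in>V \<times> V. (b p)\<^sup>2) \<le> (1 - 1 / real r) * ?s\<^sup>2" .
  have "(edge_form V F (\<lambda>u. \<bar>x u\<bar>))\<^sup>2 \<le> (\<Sum>p\<in>V \<times> V. (a p)\<^sup>2) * (\<Sum>p\<in>V \<times> V. (b p)\<^sup>2)"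
    unfolding form by (rule Cauchy_Schwarz_ineq_sum)
  also have "\<dots> \<le> 2 * real (card F) * ((1 - 1 / real r) * ?s\<^sup>2)"
    unfolding A using B by (intro mult_left_mono) auto
  finally have "edge_form V F (\<lambda>u. \<bar>x u\<bar>) \<le> sqrt (2 * real (card F) * (1 - 1 / real r) * ?s\<^sup>2)"
    by (intro real_le_rsqrt) (simp only: mult.assoc)
  then show ?thesis using s by (simp add: real_sqrt_mult)
qed

section \<open>Bipartite subgraphs\<close>

lemma bipartite_clique_le_2:
  assumes "bipartite V F" "clique V F C"
  shows "card C \<le> 2"
proof -
  obtain P Q where PQ: "P \<union> Q = V" "P \<inter> Q = {}" "\<forall>e\<in>F. \<exists>u\<in>P. \<exists>v\<in>Q. e = {u, v}"
    using assms(1) by (auto simp: bipartite_def)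
  have C: "C = (C \<inter> P) \<union> (C \<inter> Q)" using assms(2) PQ by (auto simp: clique_def)
  have eq: "u = v" if "u \<in> C" "v \<in> C" "(u \<in> P \<and> v \<in> P) \<or> (u \<in> Q \<and> v \<in> Q)" for u v
  proof (rule ccontr)
    assume "u \<noteq> v"
    then have "{u, v} \<in> F" using that assms(2) by (auto simp: clique_def)
    then obtain p q where "p \<in> P" "q \<in> Q" "{u, v} = {p, q}" using PQ by blast
    then show False using that PQ by (auto simp: doubleton_eq_iff)
  qed
  have side: "card A \<le> 1" if "\<And>u v. u \<in> A \<Longrightarrow> v \<in> A \<Longrightarrow> u = v" for A :: "'a set"
    using that by (metis One_nat_def card.infinite card_le_Suc0_iff_eq zero_le)
  have "card C \<le> card (C \<inter> P) + card (C \<inter> Q)" by (subst C) (rule card_Un_le)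
  moreover have "card (C \<inter> P) \<le> 1" by (rule side) (use eq in auto)
  moreover have "card (C \<inter> Q) \<le> 1" by (rule side) (use eq in auto)
  ultimately show ?thesis by simp
qed

text \<open>Deleting the edges outside a bipartite subgraph is one way to make the graph bipartite.\<close>

lemma bipartite_card_le:
  assumes "finite F" "H \<subseteq> F" "bipartite V H"
  shows "real (card H) \<le> real (card F) - real (edge_bipartiteness V F)"
proof -
  have "finite {card A |A. A \<subseteq> F \<and> bipartite V (F - A)}"
    by (rule finite_subset[of _ "card ` Pow F"]) (use assms in auto)
  moreover have "F - (F - H) = H" using assms by auto
  ultimately have "edge_bipartiteness V F \<le> card (F - H)"
    unfolding edge_bipartiteness_def using assms by (intro Min_le) auto
  moreover have "card H + card (F - H) = card F"
    using assms by (metis card_Diff_subset card_mono finite_subset le_add_diff_inverse)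
  ultimately show ?thesis by linarith
qed

text \<open>
  Here \<open>H\<close> consists of the edges across the sign cut of \<open>x\<close>. The remaining edges contribute
  nonnegative terms, and \<open>H\<close> is bipartite, so that Nikiforov's bound with \<open>r = 2\<close> turns into
  \<open>\<surd>|H|\<close>.
\<close>

lemma edge_form_ge_bipartiteness:
  assumes G: "simple_graph V F"
  shows "- sqrt (real (card F) - real (edge_bipartiteness V F)) * (\<Sum>u\<in>V. (x u)\<^sup>2)
    \<le> edge_form V F x"
proof -
  let ?s = "\<Sum>u\<in>V. (x u)\<^sup>2"
  define H where "H = {e \<in> F. \<exists>u\<in>V. \<exists>v\<in>V. 0 \<le> x u \<and> x v < 0 \<and> e = {u, v}}"
  have HF: "H \<subseteq> F" by (auto simp: H_def)
  have bip: "bipartite V H"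
    unfolding bipartite_def
    by (rule exI[of _ "{u \<in> V. 0 \<le> x u}"], rule exI[of _ "{u \<in> V. x u < 0}"])
      (auto simp: H_def)
  have "- edge_form V H (\<lambda>u. \<bar>x u\<bar>) \<le> edge_form V F x"
    unfolding edge_form_def sum_negf[symmetric]
  proof (intro sum_mono)
    fix u w assume "u \<in> V" "w \<in> V"
    show "- (of_bool ({u, w} \<in> H) * (\<bar>x u\<bar> * \<bar>x w\<bar>)) \<le> of_bool ({u, w} \<in> F) * (x u * x w)"
    proof (cases "{u, w} \<in> H")
      case True
      then show ?thesis using HF abs_ge_minus_self[of "x u * x w"]
        by (auto simp: abs_mult)
    next
      case False
      have "0 \<le> x u * x w" if F: "{u, w} \<in> F"
      proof (rule ccontr)
        assume "\<not> 0 \<le> x u * x w"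
        then have "(0 \<le> x u \<and> x w < 0) \<or> (0 \<le> x w \<and> x u < 0)"
          by (auto simp: zero_le_mult_iff not_le)
        then have "{u, w} \<in> H"
          using F \<open>u \<in> V\<close> \<open>w \<in> V\<close> unfolding H_def by (auto simp: insert_commute)
        then show False using False by simp
      qed
      then show ?thesis using False by auto
    qed
  qed
  moreover have "edge_form V H (\<lambda>u. \<bar>x u\<bar>) \<le> sqrt (2 * real (card H) * (1 - 1 / real 2)) * ?s"
    by (rule edge_form_abs_le[OF simple_graph_subset[OF G HF] bipartite_clique_le_2[OF bip]])
  moreover have "sqrt (2 * real (card H) * (1 - 1 / real 2)) * ?s
      \<le> sqrt (real (card F) - real (edge_bipartiteness V F)) * ?s"
    using bipartite_card_le[OF simple_graph_finite_edges[OF G] HF bip]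
    by (intro mult_right_mono) (auto intro: sum_nonneg)
  ultimately show ?thesis by simp
qed

section \<open>Eigenvalues of matrices indexed by vertices\<close>

text \<open>
  This removes the enumeration of the vertices: eigenvectors become functions on the vertex set. It
  is stated over any field because the existence of a real eigenvalue is derived from the
  complex case.
\<close>

lemma eigenvalue_vertex_iff:
  fixes a :: "'a \<Rightarrow> 'a \<Rightarrow> 'k :: field"
  assumes "distinct vs"
  shows "eigenvalue (mat (length vs) (length vs) (\<lambda>(i, j). a (vs ! i) (vs ! j))) k
    \<longleftrightarrow> (\<exists>x. (\<exists>u\<in>set vs. x u \<noteq> 0) \<and> (\<forall>u\<in>set vs. (\<Sum>w\<in>set vs. a u w * x w) = k * x u))"
    (is "eigenvalue ?M k \<longleftrightarrow> ?R")
proof -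
  let ?n = "length vs"
  have bij: "bij_betw ((!) vs) {..<?n} (set vs)"
    using assms by (simp add: bij_betw_nth)
  have sum: "(\<Sum>w\<in>set vs. f w) = (\<Sum>j = 0..<?n. f (vs ! j))" for f :: "'a \<Rightarrow> 'k"
    using sum.reindex_bij_betw[OF bij, of f] by (simp add: lessThan_atLeast0)
  have ev: "(?M *\<^sub>v v = k \<cdot>\<^sub>v v) \<longleftrightarrow> (\<forall>i<?n. (\<Sum>j = 0..<?n. a (vs ! i) (vs ! j) * v $ j) = k * v $ i)"
    if "v \<in> carrier_vec ?n" for v
    using that by (auto simp: vec_eq_iff scalar_prod_def)
  have nz: "v \<noteq> 0\<^sub>v ?n \<longleftrightarrow> (\<exists>i<?n. v $ i \<noteq> 0)" if "v \<in> carrier_vec ?n" for v :: "'k vec"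
    using that by (auto simp: vec_eq_iff)
  show ?thesis
  proof
    assume "eigenvalue ?M k"
    then obtain v where v: "v \<in> carrier_vec ?n" "v \<noteq> 0\<^sub>v ?n" "?M *\<^sub>v v = k \<cdot>\<^sub>v v"
      by (auto simp: eigenvalue_def eigenvector_def)
    define x where "x u = v $ (the_inv_into {..<?n} ((!) vs) u)" for u
    have x: "x (vs ! i) = v $ i" if "i < ?n" for i
      using that bij unfolding x_def by (simp add: the_inv_into_f_f bij_betw_def)
    show ?R
    proof (rule exI[of _ x], intro conjI ballI)
      show "\<exists>u\<in>set vs. x u \<noteq> 0" using nz[OF v(1)] v(2) x by (metis nth_mem)
      fix u assume "u \<in> set vs"
      then obtain i where "i < ?n" "u = vs ! i" by (auto simp: in_set_conv_nth)
      then show "(\<Sum>w\<in>set vs. a u w * x w) = k * x u"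
        using ev[OF v(1)] v(3) by (simp add: sum x)
    qed
  next
    assume ?R
    then obtain x where x: "\<exists>u\<in>set vs. x u \<noteq> 0"
      "\<forall>u\<in>set vs. (\<Sum>w\<in>set vs. a u w * x w) = k * x u" by blast
    let ?v = "vec ?n (\<lambda>i. x (vs ! i))"
    have "?v \<noteq> 0\<^sub>v ?n"
    proof -
      obtain i where "i < ?n" "x (vs ! i) \<noteq> 0" using x(1) by (auto simp: in_set_conv_nth)
      then show ?thesis by (subst nz) auto
    qed
    moreover have "?M *\<^sub>v ?v = k \<cdot>\<^sub>v ?v"
      using x(2) by (subst ev) (auto simp: sum)
    ultimately show "eigenvalue ?M k"
      by (auto simp: eigenvalue_def eigenvector_def intro!: exI[of _ ?v])
  qed
qed

text \<open>
  Over the complex numbers an eigenvalue \<open>k\<close> with an eigenvector \<open>z\<close> exists. The number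
  \<open>q = z\<^sup>* A z\<close> is real by symmetry and equals \<open>k \<parallel>z\<parallel>\<^sup>2\<close>, so \<open>k\<close> is real. Then the real and the
  imaginary part of \<open>z\<close> both satisfy the eigenvalue equation, and one of them is nonzero.
\<close>

lemma symmetric_eigenvalue_exists:
  fixes a :: "'a \<Rightarrow> 'a \<Rightarrow> real"
  assumes vs: "distinct vs" "vs \<noteq> []" and symm: "\<And>u w. a u w = a w u"
  shows "\<exists>k. eigenvalue (mat (length vs) (length vs) (\<lambda>(i, j). a (vs ! i) (vs ! j))) k"
proof -
  let ?M = "mat (length vs) (length vs) (\<lambda>(i, j). complex_of_real (a (vs ! i) (vs ! j)))"
  let ?V = "set vs"
  have "spectrum ?M \<noteq> {}" by (rule spectrum_non_empty[of _ "length vs"]) (use vs in auto)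
  then obtain k where "eigenvalue ?M k" by (auto simp: spectrum_def)
  then obtain z where nz: "\<exists>u\<in>?V. z u \<noteq> 0"
    and z: "\<forall>u\<in>?V. (\<Sum>w\<in>?V. complex_of_real (a u w) * z w) = k * z u"
    unfolding eigenvalue_vertex_iff[OF vs(1), of "\<lambda>u w. complex_of_real (a u w)"] by blast
  define q where "q = (\<Sum>u\<in>?V. \<Sum>w\<in>?V. complex_of_real (a u w) * (cnj (z u) * z w))"
  have "cnj q = q"
    unfolding q_def by (subst sum.swap) (simp add: symm mult_ac)
  moreover have "q = k * complex_of_real (\<Sum>u\<in>?V. (cmod (z u))\<^sup>2)"
  proof -
    have "q = (\<Sum>u\<in>?V. cnj (z u) * (\<Sum>w\<in>?V. complex_of_real (a u w) * z w))"
      unfolding q_def by (simp add: sum_distrib_left mult_ac)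
    also have "\<dots> = (\<Sum>u\<in>?V. k * complex_of_real ((cmod (z u))\<^sup>2))"
    proof (rule sum.cong[OF refl])
      fix u assume "u \<in> ?V"
      then have "cnj (z u) * (\<Sum>w\<in>?V. complex_of_real (a u w) * z w) = k * (z u * cnj (z u))"
        unfolding bspec[OF z \<open>u \<in> ?V\<close>] by (simp add: mult_ac)
      then show "cnj (z u) * (\<Sum>w\<in>?V. complex_of_real (a u w) * z w)
          = k * complex_of_real ((cmod (z u))\<^sup>2)"
        by (simp only: complex_norm_square)
    qed
    finally show ?thesis by (simp only: of_real_sum sum_distrib_left)
  qed
  moreover have "(\<Sum>u\<in>?V. (cmod (z u))\<^sup>2) \<noteq> 0"
    using nz by (subst sum_nonneg_eq_0_iff) auto
  ultimately have "cnj k = k"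
    by (auto simp del: of_real_sum)
  then have k: "Im k = 0" by (simp add: complex_eq_iff)
  have re: "(\<Sum>w\<in>?V. a u w * Re (z w)) = Re k * Re (z u)"
    and im: "(\<Sum>w\<in>?V. a u w * Im (z w)) = Re k * Im (z u)" if "u \<in> ?V" for u
    using arg_cong[OF bspec[OF z that], of Re] arg_cong[OF bspec[OF z that], of Im] k by auto
  have "(\<exists>u\<in>?V. Re (z u) \<noteq> 0) \<or> (\<exists>u\<in>?V. Im (z u) \<noteq> 0)"
    using nz by (auto simp: complex_eq_iff)
  then obtain x where "\<exists>u\<in>?V. x u \<noteq> 0" "\<forall>u\<in>?V. (\<Sum>w\<in>?V. a u w * x w) = Re k * x u"
  proof
    assume "\<exists>u\<in>?V. Re (z u) \<noteq> 0"
    then show thesis using re by (intro that[of "\<lambda>u. Re (z u)"]) auto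
  next
    assume "\<exists>u\<in>?V. Im (z u) \<noteq> 0"
    then show thesis using im by (intro that[of "\<lambda>u. Im (z u)"]) auto
  qed
  then have "eigenvalue (mat (length vs) (length vs) (\<lambda>(i, j). a (vs ! i) (vs ! j))) (Re k)"
    unfolding eigenvalue_vertex_iff[OF vs(1)] by (intro exI[of _ x] conjI)
  then show ?thesis ..
qed

lemma finite_eigenvalues: "finite {k :: real. eigenvalue (adj_matrix vs E \<sigma>) k}"
  using card_finite_spectrum(1)[of "adj_matrix vs E \<sigma>" "length vs"]
  by (simp add: spectrum_def adj_matrix_def)

definition signed_adj :: "'a set set \<Rightarrow> ('a set \<Rightarrow> int) \<Rightarrow> 'a \<Rightarrow> 'a \<Rightarrow> real" where
  "signed_adj E \<sigma> u w = (if {u, w} \<in> E then of_int (\<sigma> {u, w}) else 0)"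

lemma adj_matrix_eq:
  "adj_matrix vs E \<sigma> = mat (length vs) (length vs) (\<lambda>(i, j). signed_adj E \<sigma> (vs ! i) (vs ! j))"
  by (simp add: adj_matrix_def signed_adj_def)

text \<open>
  Pairing the eigenvalue equation with the eigenvector \<open>x\<close> turns \<open>k \<parallel>x\<parallel>\<^sup>2\<close> into the difference of
  the forms of the positive and the negative edges. Replacing \<open>x\<close> by \<open>\<bar>x\<bar>\<close> in the negative part can
  only increase it, and then Nikiforov's bound applies there.
\<close>

lemma eigenvalue_lower_bound:
  assumes G: "signed_graph V E \<sigma>" and vs: "distinct vs" "set vs = V"
    and cl: "\<And>C. clique V (neg_edges E \<sigma>) C \<Longrightarrow> card C \<le> r"
    and ev: "eigenvalue (adj_matrix vs E \<sigma>) k"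
  shows "- sqrt (real (card (pos_edges E \<sigma>)) - real (edge_bipartiteness V (pos_edges E \<sigma>)))
    - sqrt (2 * real (card (neg_edges E \<sigma>)) * (1 - 1 / real r)) \<le> k"
    (is "- ?p - ?m \<le> k")
proof -
  have GE: "simple_graph V E" using G by (simp add: signed_graph_def)
  have GP: "simple_graph V (pos_edges E \<sigma>)" and GN: "simple_graph V (neg_edges E \<sigma>)"
    by (auto intro!: simple_graph_subset[OF GE] simp: pos_edges_def neg_edges_def)
  obtain x where nz: "\<exists>u\<in>V. x u \<noteq> 0"
    and x: "\<forall>u\<in>V. (\<Sum>w\<in>V. signed_adj E \<sigma> u w * x w) = k * x u"
    using ev unfolding adj_matrix_eq eigenvalue_vertex_iff[OF vs(1)] vs(2) by blast
  let ?s = "\<Sum>u\<in>V. (x u)\<^sup>2"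
  have s: "0 < ?s"
    using nz GE by (metis (mono_tags, lifting) simple_graph_def sum_pos2 zero_le_power2 zero_less_power2)
  have "k * ?s = (\<Sum>u\<in>V. x u * (\<Sum>w\<in>V. signed_adj E \<sigma> u w * x w))"
    using x by (simp add: sum_distrib_left power2_eq_square mult_ac)
  also have "\<dots> = (\<Sum>u\<in>V. \<Sum>w\<in>V. of_bool ({u, w} \<in> pos_edges E \<sigma>) * (x u * x w)
      - of_bool ({u, w} \<in> neg_edges E \<sigma>) * (x u * x w))"
    unfolding sum_distrib_left using G
    by (intro sum.cong)
      (auto simp: signed_adj_def pos_edges_def neg_edges_def signed_graph_def)
  also have "\<dots> = edge_form V (pos_edges E \<sigma>) x - edge_form V (neg_edges E \<sigma>) x"
    by (simp add: edge_form_def sum_subtractf)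
  finally have "k * ?s = edge_form V (pos_edges E \<sigma>) x - edge_form V (neg_edges E \<sigma>) x" .
  moreover have "edge_form V (neg_edges E \<sigma>) x \<le> edge_form V (neg_edges E \<sigma>) (\<lambda>u. \<bar>x u\<bar>)"
    unfolding edge_form_def
    by (intro sum_mono mult_left_mono) (auto simp flip: abs_mult)
  moreover have "edge_form V (neg_edges E \<sigma>) (\<lambda>u. \<bar>x u\<bar>) \<le> ?m * ?s"
    by (rule edge_form_abs_le[OF GN cl])
  moreover have "- ?p * ?s \<le> edge_form V (pos_edges E \<sigma>) x"
    by (rule edge_form_ge_bipartiteness[OF GP])
  ultimately have "(- ?p - ?m) * ?s \<le> k * ?s" by (simp add: algebra_simps)
  then show ?thesis using s by (simp add: mult_le_cancel_right)
qed

section \<open>Complete and complete bipartite graphs\<close>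

lemma clique_number_eqI:
  assumes "clique V E C" "card C = r" "\<And>D. clique V E D \<Longrightarrow> card D \<le> r"
  shows "clique_number V E = r"
proof -
  have "finite {card D |D. clique V E D}"
    by (rule finite_subset[of _ "{..r}"]) (use assms(3) in auto)
  then show ?thesis unfolding clique_number_def using assms by (intro Max_eqI) auto
qed

lemma clique_le_clique_number:
  assumes "finite V" "clique V E C"
  shows "card C \<le> clique_number V E"
proof -
  have "finite {card D |D. clique V E D}"
    by (rule finite_subset[of _ "card ` Pow V"]) (use assms(1) in \<open>auto simp: clique_def\<close>)
  then show ?thesis unfolding clique_number_def using assms(2) by (intro Max_ge) auto
qed

lemma complete_graph_eigenvalue:
  assumes "is_complete_graph n V E" "all_negative E \<sigma>" "distinct vs" "set vs = V" "V \<noteq> {}"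
  shows "eigenvalue (adj_matrix vs E \<sigma>) (- (real n - 1))"
proof -
  have V: "finite V" "card V = n" and E: "E = {e. e \<subseteq> V \<and> card e = 2}"
    using assms by (auto simp: is_complete_graph_def)
  have adj: "signed_adj E \<sigma> u w = (if w = u then 1 else 0) - 1" if "u \<in> V" "w \<in> V" for u w
    using that assms(2) by (auto simp: signed_adj_def E all_negative_def)
  have "(\<Sum>w\<in>V. signed_adj E \<sigma> u w * 1) = - (real n - 1) * 1" if "u \<in> V" for u
    using that V by (simp add: adj sum_subtractf)
  then show ?thesis
    unfolding adj_matrix_eq eigenvalue_vertex_iff[OF assms(3)] assms(4) using assms(5)
    by (intro exI[of _ "\<lambda>_. 1"]) auto
qed

lemma complete_graph_clique_number:
  assumes "is_complete_graph n V E"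
  shows "clique_number V E = n"
proof (rule clique_number_eqI)
  show "clique V E V" using assms by (auto simp: clique_def is_complete_graph_def)
  show "card V = n" using assms by (simp add: is_complete_graph_def)
  show "card D \<le> n" if "clique V E D" for D
    using that assms by (auto simp: clique_def is_complete_graph_def intro: card_mono)
qed

lemma complete_graph_card_edges:
  assumes "is_complete_graph n V E"
  shows "2 * real (card E) = real n * (real n - 1)"
proof -
  have "card E = n choose 2"
    using assms n_subsets[of V 2] by (simp add: is_complete_graph_def)
  moreover have "2 * (n choose 2) = n * (n - 1)"
    unfolding choose_two by (intro dvd_mult_div_cancel) (cases n; simp)
  ultimately have "2 * card E = n * (n - 1)" by simp
  then have "2 * real (card E) = real (n * (n - 1))"
    by (metis of_nat_mult of_nat_numeral)
  then show ?thesis by (cases n) (auto simp: algebra_simps)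
qed

lemma complete_bipartite_eigenvalue:
  assumes "is_complete_bipartite p q V E" "all_negative E \<sigma>" "distinct vs" "set vs = V" "E \<noteq> {}"
  shows "eigenvalue (adj_matrix vs E \<sigma>) (- sqrt (real p * real q))"
proof -
  obtain P Q where PQ: "finite P" "finite Q" "card P = p" "card Q = q" "P \<union> Q = V" "P \<inter> Q = {}"
    and E: "E = {{u, v} |u v. u \<in> P \<and> v \<in> Q}"
    using assms(1) by (auto simp: is_complete_bipartite_def)
  have mem: "{u, w} \<in> E \<longleftrightarrow> (u \<in> P \<and> w \<in> Q) \<or> (u \<in> Q \<and> w \<in> P)" for u w
    unfolding E by (auto simp: doubleton_eq_iff)
  have adj: "signed_adj E \<sigma> u w = - of_bool ((u \<in> P \<and> w \<in> Q) \<or> (u \<in> Q \<and> w \<in> P))" for u w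
    using assms(2) by (auto simp: signed_adj_def all_negative_def mem)
  define x where "x u = (if u \<in> P then sqrt (real q) else sqrt (real p))" for u
  have "(\<Sum>w\<in>V. signed_adj E \<sigma> u w * x w) = - sqrt (real p * real q) * x u" if u: "u \<in> V" for u
  proof -
    have "(\<Sum>w\<in>V. signed_adj E \<sigma> u w * x w)
        = (\<Sum>w\<in>P. signed_adj E \<sigma> u w * x w) + (\<Sum>w\<in>Q. signed_adj E \<sigma> u w * x w)"
      using PQ by (metis sum.union_disjoint)
    also have "(\<Sum>w\<in>P. signed_adj E \<sigma> u w * x w) = (\<Sum>w\<in>P. - of_bool (u \<in> Q) * sqrt (real q))"
      using PQ by (intro sum.cong) (auto simp: adj x_def)
    also have "(\<Sum>w\<in>Q. signed_adj E \<sigma> u w * x w) = (\<Sum>w\<in>Q. - of_bool (u \<in> P) * sqrt (real p))"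
      using PQ by (intro sum.cong) (auto simp: adj x_def)
    finally have eq: "(\<Sum>w\<in>V. signed_adj E \<sigma> u w * x w)
        = - real p * of_bool (u \<in> Q) * sqrt (real q) - real q * of_bool (u \<in> P) * sqrt (real p)"
      using PQ by simp
    consider "u \<in> P" "u \<notin> Q" | "u \<notin> P" "u \<in> Q" using u PQ(5,6) by blast
    then show ?thesis
    proof cases
      case 1
      then have "x u = sqrt (real q)" by (simp add: x_def)
      moreover have "sqrt (real p * real q) * sqrt (real q) = real q * sqrt (real p)"
        unfolding real_sqrt_mult by simp
      ultimately show ?thesis using 1 by (simp add: eq)
    next
      case 2
      then have "x u = sqrt (real p)" by (simp add: x_def)
      moreover have "sqrt (real p * real q) * sqrt (real p) = real p * sqrt (real q)"
        unfolding real_sqrt_mult by simp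
      ultimately show ?thesis using 2 by (simp add: eq)
    qed
  qed
  moreover have "\<exists>u\<in>V. x u \<noteq> 0"
  proof -
    obtain u v where "u \<in> P" "v \<in> Q" using assms(5) E by auto
    then have "x u \<noteq> 0" "u \<in> V" using PQ by (auto simp: x_def)
    then show ?thesis by blast
  qed
  ultimately show ?thesis
    unfolding adj_matrix_eq eigenvalue_vertex_iff[OF assms(3)] assms(4) by blast
qed

lemma complete_bipartite_bipartite:
  assumes "is_complete_bipartite p q V E"
  shows "bipartite V E"
  using assms unfolding is_complete_bipartite_def bipartite_def by blast

lemma complete_bipartite_clique_number:
  assumes "is_complete_bipartite p q V E" "E \<noteq> {}"
  shows "clique_number V E = 2"
proof -
  obtain P Q where PQ: "P \<union> Q = V" "P \<inter> Q = {}" and E: "E = {{u, v} |u v. u \<in> P \<and> v \<in> Q}"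
    using assms(1) by (auto simp: is_complete_bipartite_def)
  obtain u v where uv: "u \<in> P" "v \<in> Q" using assms(2) E by auto
  show ?thesis
  proof (rule clique_number_eqI)
    show "clique V E {u, v}" using uv PQ unfolding clique_def E by (auto simp: doubleton_eq_iff)
    have "u \<noteq> v" using uv PQ by blast
    then show "card {u, v} = 2" by simp
  qed (rule bipartite_clique_le_2[OF complete_bipartite_bipartite[OF assms(1)]])
qed

lemma complete_bipartite_card_edges:
  assumes "is_complete_bipartite p q V E"
  shows "card E = p * q"
proof -
  obtain P Q where PQ: "card P = p" "card Q = q" "P \<inter> Q = {}"
    and E: "E = {{u, v} |u v. u \<in> P \<and> v \<in> Q}"
    using assms(1) by (auto simp: is_complete_bipartite_def)
  have "E = (\<lambda>(u, v). {u, v}) ` (P \<times> Q)" unfolding E by auto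
  moreover have "inj_on (\<lambda>(u, v). {u, v}) (P \<times> Q)"
    using PQ by (auto simp: inj_on_def doubleton_eq_iff)
  ultimately show ?thesis using PQ by (simp add: card_image card_cartesian_product)
qed

lemma edge_bipartiteness_empty: "edge_bipartiteness V {} = 0"
proof -
  have "bipartite V {}" by (auto simp: bipartite_def)
  then have "{card F |F. F \<subseteq> {} \<and> bipartite V ({} - F)} = {0}" by auto
  then show ?thesis by (simp add: edge_bipartiteness_def)
qed

theorem theorem5p18:
  fixes V :: "'a set" and E :: "'a set set" and \<sigma> :: "'a set \<Rightarrow> int"
    and vs :: "'a list" and n m_pos m_neg :: nat
  assumes "signed_graph V E \<sigma>"
    and "card V = n"
    and "distinct vs" and "set vs = V"
    and "neg_edges E \<sigma> \<noteq> {}"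
    and "card (pos_edges E \<sigma>) = m_pos"
    and "card (neg_edges E \<sigma>) = m_neg"
  shows
    "let lam = least_eigenvalue (adj_matrix vs E \<sigma>);
         bound = - sqrt (real m_pos - real (edge_bipartiteness V (pos_edges E \<sigma>)))
                 - sqrt (2 * real m_neg * (1 - 1 / real (clique_number V (neg_edges E \<sigma>))))
     in lam \<ge> bound
        \<and> (is_complete_graph n V E \<and> all_negative E \<sigma> \<longrightarrow> lam = bound)
        \<and> (\<forall>p q. p + q = n \<and> is_complete_bipartite p q V E \<and> all_negative E \<sigma> \<longrightarrow> lam = bound)"
proof -
  let ?A = "adj_matrix vs E \<sigma>"
  define lam where "lam = least_eigenvalue ?A"
  define bound where "bound = - sqrt (real m_pos - real (edge_bipartiteness V (pos_edges E \<sigma>)))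
    - sqrt (2 * real m_neg * (1 - 1 / real (clique_number V (neg_edges E \<sigma>))))"
  have GE: "simple_graph V E" and fV: "finite V"
    using assms(1) by (auto simp: signed_graph_def simple_graph_def)
  obtain e where "e \<in> neg_edges E \<sigma>" using assms(5) by blast
  then have "e \<subseteq> V" "card e = 2" "E \<noteq> {}"
    using GE by (auto simp: neg_edges_def simple_graph_def)
  then have Vne: "V \<noteq> {}" and Ene: "E \<noteq> {}" by auto
  then have n0: "n > 0" using fV assms(2) by (auto simp: card_gt_0_iff)
  have "\<exists>k. eigenvalue ?A k"
    unfolding adj_matrix_eq
    by (rule symmetric_eigenvalue_exists)
      (use assms(3,4) Vne in \<open>auto simp: signed_adj_def insert_commute\<close>)
  then have "eigenvalue ?A lam"
    unfolding lam_def least_eigenvalue_def using Min_in[OF finite_eigenvalues[of vs E \<sigma>]] by blast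
  then have lower: "bound \<le> lam"
    using eigenvalue_lower_bound[OF assms(1,3,4) clique_le_clique_number[OF fV]]
    unfolding bound_def assms(6,7) by blast
  have tight: "lam = bound" if "eigenvalue ?A bound"
    using lower that Min_le[OF finite_eigenvalues, of bound vs E \<sigma>]
    unfolding lam_def least_eigenvalue_def by force
  have neg: "bound = - sqrt (2 * real (card E) * (1 - 1 / real (clique_number V E)))"
    if "all_negative E \<sigma>"
  proof -
    have "neg_edges E \<sigma> = E" "pos_edges E \<sigma> = {}"
      using that by (auto simp: all_negative_def neg_edges_def pos_edges_def)
    then show ?thesis
      using assms(6,7) unfolding bound_def by (simp add: edge_bipartiteness_empty)
  qed
  have complete: "lam = bound" if K: "is_complete_graph n V E" "all_negative E \<sigma>"
  proof (rule tight)
    have "2 * real (card E) * (1 - 1 / real (clique_number V E)) = (real n - 1)\<^sup>2"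
      unfolding complete_graph_card_edges[OF K(1)] complete_graph_clique_number[OF K(1)]
      using n0 by (simp add: field_simps power2_eq_square)
    then have "bound = - (real n - 1)" using neg[OF K(2)] n0 by simp
    then show "eigenvalue ?A bound"
      using complete_graph_eigenvalue[OF K assms(3,4) Vne] by simp
  qed
  have complete_bipartite: "lam = bound"
    if K: "is_complete_bipartite p q V E" "all_negative E \<sigma>" for p q
  proof (rule tight)
    have "bound = - sqrt (real p * real q)"
      unfolding neg[OF K(2)] complete_bipartite_card_edges[OF K(1)]
        complete_bipartite_clique_number[OF K(1) Ene] by simp
    then show "eigenvalue ?A bound"
      using complete_bipartite_eigenvalue[OF K assms(3,4) Ene] by simp
  qed
  show ?thesis
    using lower complete complete_bipartite
    unfolding Let_def lam_def[symmetric] bound_def[symmetric] by blast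
qed

end
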